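(* Let Burgers' equation be discretized with the first-order upwind scheme $$\frac{d}{dt}q_i=R_i(\underline{q})=-\frac1{\Delta x}\big(f(q_i)-f(q_{i-1})\big),\qquad f(q)=\frac{q^2}{2},$$ and let $\underline{q}^n$ satisfy $0\le q_i^n\le 1$ for all $i$. Consider an explicit $s$-stage Runge-Kutta method whose coefficients satisfy $0\le a_{ij},c_i,b_j\le1$ for all $i,j$. Then there exists $\Delta t^*>0$ such that for all $0<\Delta t\le\Delta t^*$, $$TV(\underline{q}^j)\le TV(\underline{q}^n)\quad (j=1,\dots,s)\qquad\text{and}\qquad TV(\underline{q}^{RK})\le TV(\underline{q}^n).$$
   Context: $\underline{q}=(q_i)\in\mathbb{R}^N$ is a finite grid vector with indices understood periodically (mod $N$), $\Delta x>0$ is the grid spacing, and $TV(\underline{q})=\sum_i|q_{i+1}-q_i|$. An explicit $s$-stage Runge-Kutta method has real coefficients $a_{ij}$ ($1\le i,j\le s$, $a_{ij}=0$ for $j\ge i$), $b_j$, and $c_i=\sum_{j=1}^s a_{ij}$, with $\sum_{j=1}^s b_j=1$. Starting from $\underline{q}^n$ with step size $\Delta t$: $\underline{q}^i=\underline{q}^n+\Delta t\sum_{j=1}^s a_{ij}\underline{R}^j$, $\underline{R}^i=R(\underline{q}^i)$ for $i=1,\dots,s$, and $\underline{q}^{RK}=\underline{q}^n+\Delta t\sum_{j=1}^s b_j\underline{R}^j$ (superscripts denote stages, subscripts on $q$ denote grid points). *)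

theory Defs
  imports Complex_Main
begin

text \<open>
  A grid vector with \<open>N\<close> entries is a function of type \<open>nat \<Rightarrow> real\<close> of which only the values
  at the indices \<open>0, \<dots>, N - 1\<close> matter. Periodicity is expressed by reducing the neighbouring
  indices modulo \<open>N\<close>.
\<close>

type_synonym grid_vec = "nat \<Rightarrow> real"

definition TV :: "nat \<Rightarrow> grid_vec \<Rightarrow> real" where
  "TV N q = (\<Sum>i<N. \<bar>q ((i + 1) mod N) - q i\<bar>)"

definition burgers_flux :: "real \<Rightarrow> real" where
  "burgers_flux u = u\<^sup>2 / 2"

text \<open>For \<open>N \<ge> 1\<close>, \<open>(i + N - 1) mod N\<close> is the periodic index of the left neighbour \<open>i - 1\<close>.\<close>

definition upwind :: "nat \<Rightarrow> real \<Rightarrow> grid_vec \<Rightarrow> grid_vec" where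
  "upwind N \<Delta>x q =
     (\<lambda>i. - (1 / \<Delta>x) * (burgers_flux (q i) - burgers_flux (q ((i + N - 1) mod N))))"

text \<open>Stages are numbered \<open>1, \<dots>, s\<close>; coefficients outside this range are irrelevant.\<close>

definition explicit_rk :: "nat \<Rightarrow> (nat \<Rightarrow> nat \<Rightarrow> real) \<Rightarrow> (nat \<Rightarrow> real) \<Rightarrow> bool" where
  "explicit_rk s a b \<longleftrightarrow>
     (\<forall>i\<in>{1..s}. \<forall>j\<in>{1..s}. j \<ge> i \<longrightarrow> a i j = 0) \<and> (\<Sum>j=1..s. b j) = 1"

definition rk_c :: "nat \<Rightarrow> (nat \<Rightarrow> nat \<Rightarrow> real) \<Rightarrow> nat \<Rightarrow> real" where
  "rk_c s a i = (\<Sum>j=1..s. a i j)"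

text \<open>
  The stage vectors, for an arbitrary right-hand side \<open>R\<close>. The sum only runs over the earlier
  stages, so that the recursion is well-founded; for explicit methods the omitted coefficients
  vanish, and lemma \<open>rk_stage_eq\<close> recovers the sum over all stages.
\<close>

fun rk_stage ::
  "(grid_vec \<Rightarrow> grid_vec) \<Rightarrow> (nat \<Rightarrow> nat \<Rightarrow> real) \<Rightarrow> real \<Rightarrow> grid_vec \<Rightarrow> nat \<Rightarrow> grid_vec" where
  "rk_stage R a \<Delta>t q i =
     (\<lambda>k. q k + \<Delta>t * (\<Sum>j\<in>{1..<i}. a i j * R (rk_stage R a \<Delta>t q j) k))"

declare rk_stage.simps [simp del]

definition rk_step ::
  "(grid_vec \<Rightarrow> grid_vec) \<Rightarrow> nat \<Rightarrow> (nat \<Rightarrow> nat \<Rightarrow> real) \<Rightarrow> (nat \<Rightarrow> real) \<Rightarrow> real \<Rightarrow> grid_vec \<Rightarrow> grid_vec"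
  where
  "rk_step R s a b \<Delta>t q =
     (\<lambda>k. q k + \<Delta>t * (\<Sum>j=1..s. b j * R (rk_stage R a \<Delta>t q j) k))"

lemma rk_stage_eq:
  assumes "explicit_rk s a b" and "i \<in> {1..s}"
  shows "rk_stage R a \<Delta>t q i =
     (\<lambda>k. q k + \<Delta>t * (\<Sum>j=1..s. a i j * R (rk_stage R a \<Delta>t q j) k))"
proof
  fix k
  have "(\<Sum>j\<in>{1..<i}. a i j * R (rk_stage R a \<Delta>t q j) k) =
        (\<Sum>j=1..s. a i j * R (rk_stage R a \<Delta>t q j) k)"
    using assms by (intro sum.mono_neutral_left) (auto simp: explicit_rk_def)
  then show "rk_stage R a \<Delta>t q i k =
      q k + \<Delta>t * (\<Sum>j=1..s. a i j * R (rk_stage R a \<Delta>t q j) k)"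
    by (subst rk_stage.simps) simp
qed

end

theory Submission
  imports Defs
begin

text \<open>
  Give every grid point \<open>k\<close> the sign \<open>\<sigma> k\<close> of the nearest jump of \<open>q\<close> at or to the left of \<open>k\<close>.
  For small time steps a jump keeps its sign in all stages. To the right of a jump \<open>q\<close> may be
  constant; there the stages move towards the value left of the jump, the grid point at distance
  \<open>n + 1\<close> less than the one at distance \<open>n\<close> by a factor of order \<open>\<Delta>t\<close>. Hence the differences
  of stage values and of stage fluxes at \<open>k\<close> have the sign \<open>\<sigma> k\<close> in every stage. Therefore
  the total variation of a stage is \<open>\<Sum>k. \<sigma> k * (Z k - Z (k - 1))\<close>, and each flux difference \<open>G\<close>
  contributes a nonpositive multiple of
  \<open>\<Sum>k. \<sigma> k * (G k - G (k - 1)) \<ge> (\<Sum>k. \<bar>G k\<bar>) - (\<Sum>k. \<bar>G (k - 1)\<bar>) = 0\<close>.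
  The Runge-Kutta update itself is treated as stage \<open>s + 1\<close> with coefficients \<open>b\<close>.
\<close>

text \<open>
  \<open>p\<close> is the left neighbour, \<open>\<nu>\<close> the ratio \<open>\<Delta>t / \<Delta>x\<close>, \<open>Z i\<close> the \<open>i\<close>-th stage, \<open>r k\<close> the distance
  from \<open>k\<close> to the nearest jump at or to the left of \<open>k\<close>, and \<open>\<epsilon>\<close> a lower bound for the nonzero
  values and jumps of \<open>q\<close>.
\<close>

locale small_step_upwind =
  fixes I :: "nat set" and p :: "nat \<Rightarrow> nat" and q :: grid_vec
    and S :: nat and a :: "nat \<Rightarrow> nat \<Rightarrow> real" and \<nu> :: real and Z :: "nat \<Rightarrow> grid_vec"
    and \<sigma> :: "nat \<Rightarrow> real" and r :: "nat \<Rightarrow> nat" and \<epsilon> :: real and M :: nat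
  assumes bij: "bij_betw p I I"
    and q_bounds: "k \<in> I \<Longrightarrow> 0 \<le> q k \<and> q k \<le> 1"
    and a_nonneg: "i \<in> {1..S} \<Longrightarrow> j \<in> {1..<i} \<Longrightarrow> 0 \<le> a i j"
    and a_row: "i \<in> {1..S} \<Longrightarrow> (\<Sum>j\<in>{1..<i}. a i j) \<le> 1"
    and stage: "i \<in> {1..S} \<Longrightarrow> k \<in> I \<Longrightarrow>
      Z i k = q k - \<nu> * (\<Sum>j\<in>{1..<i}. a i j * (burgers_flux (Z j k) - burgers_flux (Z j (p k))))"
    and sign: "k \<in> I \<Longrightarrow> \<sigma> k = 1 \<or> \<sigma> k = - 1"
    and jump: "k \<in> I \<Longrightarrow> r k = 0 \<Longrightarrow> \<epsilon> \<le> \<sigma> k * (q k - q (p k))"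
    and flat: "k \<in> I \<Longrightarrow> r k = Suc n \<Longrightarrow> q (p k) = q k \<and> \<sigma> (p k) = \<sigma> k \<and> r (p k) = n"
    and rank_le: "k \<in> I \<Longrightarrow> r k \<le> M"
    and eps: "0 < \<epsilon>" "\<epsilon> \<le> 1"
    and q_gap: "k \<in> I \<Longrightarrow> q k = 0 \<or> \<epsilon> \<le> q k"
    and lam: "0 < \<nu>" "64 * 4 ^ M * \<nu> \<le> \<epsilon>\<^sup>2"
begin

section \<open>Deviations of the stages from \<open>q\<close> and a crude bound on them\<close>

lemma p_in: "k \<in> I \<Longrightarrow> p k \<in> I"
  using bij by (auto simp: bij_betw_def)

text \<open>The deviation is signed so that movement of a stage towards the value left of the
  nearest jump counts as positive.\<close>

definition e :: "nat \<Rightarrow> nat \<Rightarrow> real" where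
  "e i k = \<sigma> k * (q k - Z i k)"

definition E :: "nat \<Rightarrow> nat \<Rightarrow> real" where
  "E i k = \<sigma> k * (burgers_flux (q k) - burgers_flux (Z i k))"

text \<open>Will bound the ratio of \<open>e\<close> at distance \<open>n + 1\<close> from a jump to
  \<open>e\<close> at the left neighbour. The last locale assumption keeps it at most
  \<open>1 / 4\<close> for \<open>n \<le> M\<close>.\<close>

definition \<theta> :: "nat \<Rightarrow> real" where
  "\<theta> n = 4 ^ n * (16 * \<nu> / \<epsilon>\<^sup>2)"

lemma theta_nonneg: "0 \<le> \<theta> n"
  using lam by (simp add: \<theta>_def)

lemma theta_Suc: "\<theta> (Suc n) = 4 * \<theta> n"
  by (simp add: \<theta>_def)

lemma theta_le: "n \<le> M \<Longrightarrow> \<theta> n \<le> 1 / 4"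
proof -
  assume "n \<le> M"
  then have "(4::real) ^ n \<le> 4 ^ M" by (simp add: power_increasing)
  then have "64 * 4 ^ n * \<nu> \<le> 64 * 4 ^ M * \<nu>" using lam(1) by simp
  then have "64 * 4 ^ n * \<nu> \<le> \<epsilon>\<^sup>2" using lam(2) by linarith
  then show ?thesis using eps(1) by (simp add: \<theta>_def field_simps)
qed

lemma lam_le: "4 * \<nu> \<le> \<epsilon>"
proof -
  have "(1::real) \<le> 4 ^ M" by simp
  then have "64 * \<nu> \<le> 64 * 4 ^ M * \<nu>" using lam(1) by simp
  moreover have "\<epsilon>\<^sup>2 \<le> \<epsilon>" using eps by (simp add: power2_eq_square)
  ultimately show ?thesis using lam by linarith
qed

lemma flux_bounds: "\<bar>u\<bar> \<le> 5 / 4 \<Longrightarrow> 0 \<le> burgers_flux u \<and> burgers_flux u \<le> 1"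
  using abs_le_square_iff[of u "5/4"] by (simp add: burgers_flux_def power2_eq_square)

text \<open>Earlier stages are at most \<open>5 / 4\<close> in absolute value, so their fluxes lie
  in [0, 1]; with row sums at most 1 a stage moves by at most \<nu>, and
  \<open>4 * \<nu> \<le> \<epsilon>\<close>.\<close>

lemma close:
  assumes "i \<in> {1..S}" "k \<in> I"
  shows "\<bar>Z i k - q k\<bar> \<le> \<epsilon> / 4"
  using assms
proof (induction i arbitrary: k rule: less_induct)
  case (less i)
  have *: "\<bar>a i j * (burgers_flux (Z j k) - burgers_flux (Z j (p k)))\<bar> \<le> a i j"
    if j: "j \<in> {1..<i}" for j
  proof -
    have fb: "0 \<le> burgers_flux (Z j l) \<and> burgers_flux (Z j l) \<le> 1" if "l \<in> I" for l
    proof (rule flux_bounds)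
      have "\<bar>Z j l - q l\<bar> \<le> \<epsilon> / 4" using less.IH[of j l] j less.prems(1) that by auto
      then show "\<bar>Z j l\<bar> \<le> 5 / 4" using q_bounds[OF that] eps by linarith
    qed
    have "\<bar>burgers_flux (Z j k) - burgers_flux (Z j (p k))\<bar> \<le> 1"
      using fb[OF less.prems(2)] fb[OF p_in[OF less.prems(2)]] by linarith
    then show ?thesis
      using a_nonneg[OF less.prems(1) j] by (simp add: abs_mult mult_left_le)
  qed
  have "\<bar>\<Sum>j\<in>{1..<i}. a i j * (burgers_flux (Z j k) - burgers_flux (Z j (p k)))\<bar>
      \<le> (\<Sum>j\<in>{1..<i}. a i j)"
    by (rule order_trans[OF sum_abs sum_mono]) (rule *)
  also have "\<dots> \<le> 1" by (rule a_row[OF less.prems(1)])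
  finally have "\<bar>Z i k - q k\<bar> \<le> \<nu> * 1"
    unfolding stage[OF less.prems] using lam(1) by (simp add: abs_mult)
  then show ?case using lam_le by linarith
qed

lemma Z_bounds:
  assumes "i \<in> {1..S}" "k \<in> I"
  shows "\<bar>Z i k\<bar> \<le> 5 / 4"
  using close[OF assms] q_bounds[OF assms(2)] eps by linarith

section \<open>Behaviour of \<open>q\<close> and of the stages at jumps\<close>

lemma jump_flux:
  assumes "i \<in> {1..S}" "k \<in> I" "r k = 0"
  shows "\<epsilon>\<^sup>2 / 8 \<le> \<sigma> k * (burgers_flux (Z i k) - burgers_flux (Z i (p k)))"
    and "\<sigma> k * (burgers_flux (Z i k) - burgers_flux (Z i (p k))) \<le> 1"
    and "0 \<le> \<sigma> k * (Z i k - Z i (p k))"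
proof -
  note pk = p_in[OF assms(2)]
  note c = close[OF assms(1,2)] close[OF assms(1) pk] q_bounds[OF assms(2)] q_bounds[OF pk]
    jump[OF assms(2,3)] eps
  show "\<sigma> k * (burgers_flux (Z i k) - burgers_flux (Z i (p k))) \<le> 1"
    using sign[OF assms(2)] flux_bounds[OF Z_bounds[OF assms(1,2)]]
      flux_bounds[OF Z_bounds[OF assms(1) pk]] by auto
  \<comment> \<open>A flux difference is the value difference times the mean value. The jump loses
    at most \<open>\<epsilon> / 2\<close>; the mean of the two values of \<open>q\<close>, at least
    \<open>\<epsilon> / 2\<close>, loses at most \<open>\<epsilon> / 4\<close>.\<close>
  have dm: "\<epsilon> / 2 \<le> \<sigma> k * (Z i k - Z i (p k)) \<and> \<epsilon> / 4 \<le> Z i k / 2 + Z i (p k) / 2"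
    using sign[OF assms(2)]
  proof
    assume "\<sigma> k = 1"
    moreover from this have "\<epsilon> \<le> q k - q (p k)" using c by simp
    ultimately show ?thesis using c by (intro conjI; simp only: mult_1; linarith)
  next
    assume "\<sigma> k = - 1"
    moreover from this have "\<epsilon> \<le> q (p k) - q k" using c by simp
    ultimately show ?thesis using c by (intro conjI; simp only: mult_minus1; linarith)
  qed
  then show "0 \<le> \<sigma> k * (Z i k - Z i (p k))"
    using eps by linarith
  have "\<epsilon> / 2 * (\<epsilon> / 4) \<le> \<sigma> k * (Z i k - Z i (p k)) * (Z i k / 2 + Z i (p k) / 2)"
    using dm eps by (intro mult_mono) auto
  then show "\<epsilon>\<^sup>2 / 8 \<le> \<sigma> k * (burgers_flux (Z i k) - burgers_flux (Z i (p k)))"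
    by (simp add: burgers_flux_def power2_eq_square field_simps)
qed

text \<open>A plateau at height \<open>0\<close> can only be reached by a downward jump; so the flux, although
  degenerate there, is still increasing in the direction in which the plateau is perturbed.\<close>

lemma zero_sign:
  assumes "k \<in> I" "q k = 0"
  shows "\<sigma> k = - 1"
  using assms
proof (induction "r k" arbitrary: k)
  case 0
  then show ?case
    using jump[of k] sign[of k] q_bounds[OF p_in[of k]] eps by auto
next
  case (Suc n)
  then show ?case using flat[of k n] p_in[of k] by auto
qed

section \<open>Flux deviations compared with value deviations\<close>

lemma E_eq: "E i k = e i k * (q k / 2 + Z i k / 2)"
  by (simp add: E_def e_def burgers_flux_def power2_eq_square field_simps)

text \<open>On a plateau at height 0 the sign is -1, so nonnegative \<open>e\<close> means a
  nonnegative stage value; elsewhere \<open>q k\<close> is at least \<epsilon> and dominates the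
  deviation.\<close>

lemma weight_nonneg:
  assumes "i \<in> {1..S}" "k \<in> I" "0 \<le> e i k"
  shows "0 \<le> q k / 2 + Z i k / 2"
  using q_gap[OF assms(2)]
proof
  assume "q k = 0"
  then show ?thesis using zero_sign[OF assms(2)] assms(3) by (simp add: e_def)
next
  assume "\<epsilon> \<le> q k"
  then show ?thesis using close[OF assms(1,2)] eps by linarith
qed

lemma E_bounds:
  assumes "i \<in> {1..S}" "k \<in> I" "0 \<le> e i k"
  shows "0 \<le> E i k" "E i k \<le> 2 * e i k"
proof -
  show "0 \<le> E i k"
    unfolding E_eq using assms(3) weight_nonneg[OF assms] by (rule mult_nonneg_nonneg)
  have "q k / 2 + Z i k / 2 \<le> 2"
    using q_bounds[OF assms(2)] Z_bounds[OF assms(1,2)] by linarith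
  then have "e i k * (q k / 2 + Z i k / 2) \<le> e i k * 2"
    using assms(3) by (rule mult_left_mono)
  then show "E i k \<le> 2 * e i k" unfolding E_eq by simp
qed

text \<open>The factor 2 absorbs the change of weight between neighbours on a plateau. At height 0
  the weight is half of \<open>e\<close> and does not grow from \<open>p k\<close> to
  \<open>k\<close>; at positive height both weights differ from the common value of \<open>q\<close>
  by at most \<open>\<epsilon> / 8\<close>.\<close>

lemma E_ratio:
  assumes "i \<in> {1..S}" "k \<in> I" "r k = Suc n"
    and "0 \<le> e i (p k)" "0 \<le> e i k" "e i k \<le> t * e i (p k)" "t \<le> 1" "0 \<le> t"
  shows "E i k \<le> 2 * t * E i (p k)"
proof -
  note pk = p_in[OF assms(2)]
  note f = flat[OF assms(2,3)]
  have "e i k \<le> 1 * e i (p k)"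
    using assms(4,6,7) by (meson mult_right_mono order_trans)
  have "q k / 2 + Z i k / 2 \<le> 2 * (q (p k) / 2 + Z i (p k) / 2)"
    using q_gap[OF assms(2)]
  proof
    assume "q k = 0"
    with zero_sign[OF assms(2)] f \<open>e i k \<le> 1 * e i (p k)\<close> assms(4) show ?thesis
      by (simp add: e_def)
  next
    assume "\<epsilon> \<le> q k"
    moreover have "q (p k) = q k" using f by simp
    ultimately show ?thesis
      using close[OF assms(1,2)] close[OF assms(1) pk] eps unfolding distrib_left by linarith
  qed
  then have "e i k * (q k / 2 + Z i k / 2) \<le> e i k * (2 * (q (p k) / 2 + Z i (p k) / 2))"
    using assms(5) by (rule mult_left_mono)
  also have "\<dots> = 2 * (e i k * (q (p k) / 2 + Z i (p k) / 2))" by simp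
  also have "\<dots> \<le> 2 * (t * e i (p k) * (q (p k) / 2 + Z i (p k) / 2))"
    using assms(6) weight_nonneg[OF assms(1) pk assms(4)]
    by (intro mult_left_mono mult_right_mono) auto
  finally show ?thesis unfolding E_eq by (simp add: algebra_simps)
qed

section \<open>Decay of the deviations along a plateau\<close>

lemma e_sum:
  assumes "i \<in> {1..S}" "k \<in> I"
  shows "e i k = \<nu> * (\<Sum>j\<in>{1..<i}. a i j *
    (\<sigma> k * (burgers_flux (Z j k) - burgers_flux (Z j (p k)))))"
  unfolding e_def stage[OF assms] by (simp add: sum_distrib_left mult_ac)

lemma e_flat:
  assumes "i \<in> {1..S}" "k \<in> I" "r k = Suc n"
  shows "e i k = \<nu> * (\<Sum>j\<in>{1..<i}. a i j * (E j (p k) - E j k))"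
  unfolding e_sum[OF assms(1,2)] E_def using flat[OF assms(2,3)] by (simp add: algebra_simps)

text \<open>The lower bound keeps the row sum, which may be 0, so that it can later be compared with
  an upper bound containing the same row sum.\<close>

lemma e_jump_bounds:
  assumes "i \<in> {1..S}" "k \<in> I" "r k = 0"
  shows "\<nu> * (\<Sum>j\<in>{1..<i}. a i j) * (\<epsilon>\<^sup>2 / 8) \<le> e i k"
    and "e i k \<le> \<nu>"
    and "0 \<le> e i k"
proof -
  have j: "j \<in> {1..S}" if "j \<in> {1..<i}" for j using that assms(1) by auto
  have "(\<Sum>j\<in>{1..<i}. a i j * (\<epsilon>\<^sup>2 / 8)) \<le> (\<Sum>j\<in>{1..<i}. a i j *
    (\<sigma> k * (burgers_flux (Z j k) - burgers_flux (Z j (p k)))))"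
    using jump_flux(1)[OF j assms(2,3)] a_nonneg[OF assms(1)]
    by (intro sum_mono mult_left_mono) auto
  then have "\<nu> * (\<Sum>j\<in>{1..<i}. a i j * (\<epsilon>\<^sup>2 / 8)) \<le> e i k"
    unfolding e_sum[OF assms(1,2)] using lam(1) by (intro mult_left_mono) auto
  then show 1: "\<nu> * (\<Sum>j\<in>{1..<i}. a i j) * (\<epsilon>\<^sup>2 / 8) \<le> e i k"
    by (simp only: sum_distrib_right mult.assoc)
  have "(\<Sum>j\<in>{1..<i}. a i j * (\<sigma> k * (burgers_flux (Z j k) - burgers_flux (Z j (p k)))))
      \<le> (\<Sum>j\<in>{1..<i}. a i j * 1)"
    using jump_flux(2)[OF j assms(2,3)] a_nonneg[OF assms(1)]
    by (intro sum_mono mult_left_mono) auto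
  also have "\<dots> \<le> 1" using a_row[OF assms(1)] by simp
  finally show "e i k \<le> \<nu>"
    unfolding e_sum[OF assms(1,2)] using lam(1) mult_left_mono[of _ 1 \<nu>] by simp
  have "0 \<le> (\<Sum>j\<in>{1..<i}. a i j)" by (intro sum_nonneg a_nonneg[OF assms(1)])
  with 1 show "0 \<le> e i k"
    by (smt (verit) lam(1) mult_nonneg_nonneg zero_le_power2 divide_nonneg_pos)
qed

text \<open>Induction over the stages: as long as \<open>E j k\<close> lies between 0 and
  \<open>E j (p k)\<close> for the earlier stages, \<open>e_flat\<close> confines
  \<open>e i k\<close> between 0 and the inflow from the left, which \<open>ub\<close>
  controls.\<close>

lemma e_bounds_step:
  assumes k: "k \<in> I" "r k = Suc n"
    and nn: "\<And>i. i \<in> {1..S} \<Longrightarrow> 0 \<le> e i (p k)"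
    and ub: "\<And>i. i \<in> {1..S} \<Longrightarrow> \<nu> * (\<Sum>j\<in>{1..<i}. a i j * E j (p k)) \<le> \<theta> n * e i (p k)"
    and i: "i \<in> {1..S}"
  shows "0 \<le> e i k \<and> e i k \<le> \<theta> n * e i (p k)"
  using i
proof (induction i rule: less_induct)
  case (less i)
  have t: "0 \<le> \<theta> n" "\<theta> n \<le> 1 / 4"
    using theta_nonneg theta_le[of n] rank_le[OF k(1)] k(2) by simp_all
  have j: "0 \<le> E j k \<and> E j k \<le> E j (p k)" if "j \<in> {1..<i}" for j
  proof -
    have jS: "j \<in> {1..S}" using that less.prems by auto
    have ej: "0 \<le> e j k" "e j k \<le> \<theta> n * e j (p k)"
      using less.IH[OF _ jS] that by auto
    have "E j k \<le> 2 * \<theta> n * E j (p k)"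
      using E_ratio[OF jS k nn[OF jS] ej] t by simp
    also have "\<dots> \<le> 1 * E j (p k)"
      using E_bounds(1)[OF jS p_in[OF k(1)] nn[OF jS]] t by (intro mult_right_mono) auto
    finally show ?thesis using E_bounds(1)[OF jS k(1) ej(1)] by simp
  qed
  have "0 \<le> e i k"
    unfolding e_flat[OF less.prems k] using j lam(1) a_nonneg[OF less.prems]
    by (intro mult_nonneg_nonneg sum_nonneg) auto
  moreover have "e i k \<le> \<nu> * (\<Sum>j\<in>{1..<i}. a i j * E j (p k))"
    unfolding e_flat[OF less.prems k] using j lam(1) a_nonneg[OF less.prems]
    by (intro mult_left_mono sum_mono) auto
  ultimately show ?case using ub[OF less.prems] by linarith
qed

text \<open>Each grid point of a plateau moves by a small factor less than its left neighbour.\<close>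

lemma e_bounds:
  assumes "k \<in> I" "r k = Suc n" "i \<in> {1..S}"
  shows "0 \<le> e i (p k) \<and> 0 \<le> e i k \<and> e i k \<le> \<theta> n * e i (p k)"
  using assms
proof (induction n arbitrary: k i)
  case 0
  note pk = p_in[OF 0(1)]
  have rp: "r (p k) = 0" using flat[OF 0(1,2)] by simp
  have nn: "0 \<le> e i (p k)" if "i \<in> {1..S}" for i
    by (rule e_jump_bounds(3)[OF that pk rp])
  have ub: "\<nu> * (\<Sum>j\<in>{1..<i}. a i j * E j (p k)) \<le> \<theta> 0 * e i (p k)" if i: "i \<in> {1..S}" for i
  proof -
    have "E j (p k) \<le> 2 * \<nu>" if "j \<in> {1..<i}" for j
    proof -
      have jS: "j \<in> {1..S}" using that i by auto
      show ?thesis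
        using E_bounds(2)[OF jS pk nn[OF jS]] e_jump_bounds(2)[OF jS pk rp] by linarith
    qed
    then have "\<nu> * (\<Sum>j\<in>{1..<i}. a i j * E j (p k)) \<le> \<nu> * (\<Sum>j\<in>{1..<i}. a i j * (2 * \<nu>))"
      using lam(1) a_nonneg[OF i] by (intro mult_left_mono sum_mono) auto
    \<comment> \<open>Dividing \<open>2 * \<nu>\<close> by the factor
      \<open>\<epsilon>\<^sup>2 / 8\<close> of the lower bound at the jump gives the constant in
      \<theta>.\<close>
    also have "\<dots> = \<theta> 0 * (\<nu> * (\<Sum>j\<in>{1..<i}. a i j) * (\<epsilon>\<^sup>2 / 8))"
      using eps(1) by (simp add: \<theta>_def sum_distrib_right[symmetric])
    also have "\<dots> \<le> \<theta> 0 * e i (p k)"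
      using e_jump_bounds(1)[OF i pk rp] theta_nonneg by (rule mult_left_mono)
    finally show ?thesis .
  qed
  show ?case using e_bounds_step[OF 0(1,2) nn ub 0(3)] nn[OF 0(3)] by blast
next
  case (Suc n)
  note k = Suc.prems(1)
  note pk = p_in[OF k]
  note ppk = p_in[OF pk]
  have rp: "r (p k) = Suc n" using flat[OF Suc.prems(1,2)] by simp
  note IH = Suc.IH[OF pk rp]
  have t: "0 \<le> \<theta> n" "\<theta> n \<le> 1 / 4"
    using theta_nonneg theta_le[of n] rank_le[OF pk] rp by simp_all
  have ub: "\<nu> * (\<Sum>j\<in>{1..<i}. a i j * E j (p k)) \<le> \<theta> (Suc n) * e i (p k)"
    if i: "i \<in> {1..S}" for i
  proof -
    \<comment> \<open>\<open>W\<close> and \<open>V\<close> are the inflow to and the outflow from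
      \<open>p k\<close>, so \<open>e i (p k) = W - V\<close>. As \<open>V\<close> is at most half
      of \<open>W\<close>, solving for \<open>W\<close> costs a factor 2, and \<open>E_ratio\<close>
      costs another: hence the growth of \<theta> by 4 per grid point.\<close>
    define W where "W = \<nu> * (\<Sum>j\<in>{1..<i}. a i j * E j (p (p k)))"
    define V where "V = \<nu> * (\<Sum>j\<in>{1..<i}. a i j * E j (p k))"
    have Ej: "0 \<le> E j (p (p k)) \<and> E j (p k) \<le> 2 * \<theta> n * E j (p (p k))" if "j \<in> {1..<i}" for j
    proof -
      have jS: "j \<in> {1..S}" using that i by auto
      show ?thesis
        using E_ratio[OF jS pk rp] IH[OF jS] t E_bounds(1)[OF jS ppk] by simp
    qed
    have "0 \<le> W"
      unfolding W_def using Ej lam(1) a_nonneg[OF i]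
      by (intro mult_nonneg_nonneg sum_nonneg) auto
    have "V \<le> \<nu> * (\<Sum>j\<in>{1..<i}. a i j * (2 * \<theta> n * E j (p (p k))))"
      unfolding V_def using Ej lam(1) a_nonneg[OF i] by (intro mult_left_mono sum_mono) auto
    also have "\<dots> = 2 * \<theta> n * W"
      by (simp add: W_def sum_distrib_left mult_ac)
    finally have VW: "V \<le> 2 * \<theta> n * W" .
    also have "2 * \<theta> n * W \<le> 1 / 2 * W"
      using t \<open>0 \<le> W\<close> by (intro mult_right_mono) auto
    finally have "W \<le> 2 * e i (p k)"
      unfolding e_flat[OF i pk rp] V_def W_def
      by (simp add: right_diff_distrib sum_subtractf)
    then have "2 * \<theta> n * W \<le> 2 * \<theta> n * (2 * e i (p k))"
      using t by (intro mult_left_mono) auto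
    also have "\<dots> = \<theta> (Suc n) * e i (p k)" by (simp add: theta_Suc)
    finally show ?thesis using VW unfolding V_def by linarith
  qed
  show ?case
    using e_bounds_step[OF Suc.prems(1,2) _ ub Suc.prems(3)] IH Suc.prems(3) by blast
qed

section \<open>Signs of the stage differences and the total variation\<close>

lemma sign_preserved:
  assumes "i \<in> {1..S}" "k \<in> I"
  shows "0 \<le> \<sigma> k * (Z i k - Z i (p k))"
    and "0 \<le> \<sigma> k * (burgers_flux (Z i k) - burgers_flux (Z i (p k)))"
proof -
  have "0 \<le> \<sigma> k * (Z i k - Z i (p k)) \<and>
    0 \<le> \<sigma> k * (burgers_flux (Z i k) - burgers_flux (Z i (p k)))"
  proof (cases "r k")
    case 0
    have "0 \<le> \<epsilon>\<^sup>2 / 8" by simp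
    then show ?thesis using jump_flux[OF assms 0] by linarith
  next
    case (Suc n)
    \<comment> \<open>Since \<open>q\<close> and \<sigma> agree at \<open>k\<close> and
      \<open>p k\<close>, the two signed differences are \<open>e i (p k) - e i k\<close> and
      \<open>E i (p k) - E i k\<close>.\<close>
    note f = flat[OF assms(2) Suc]
    note b = e_bounds[OF assms(2) Suc assms(1)]
    have t: "0 \<le> \<theta> n" "\<theta> n \<le> 1 / 4"
      using theta_nonneg theta_le[of n] rank_le[OF assms(2)] Suc by simp_all
    have "\<theta> n * e i (p k) \<le> 1 * e i (p k)"
      using b t by (intro mult_right_mono) auto
    then have "e i k \<le> e i (p k)" using b by linarith
    moreover have "E i k \<le> E i (p k)"
    proof -
      have "2 * \<theta> n * E i (p k) \<le> 1 * E i (p k)"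
        using E_bounds(1)[OF assms(1) p_in[OF assms(2)]] b t by (intro mult_right_mono) auto
      then show ?thesis using E_ratio[OF assms Suc] b t by fastforce
    qed
    ultimately show ?thesis using f by (simp add: e_def E_def algebra_simps)
  qed
  then show "0 \<le> \<sigma> k * (Z i k - Z i (p k))"
    "0 \<le> \<sigma> k * (burgers_flux (Z i k) - burgers_flux (Z i (p k)))" by auto
qed

lemma variation_le:
  assumes "i \<in> {1..S}"
  shows "(\<Sum>k\<in>I. \<bar>Z i k - Z i (p k)\<bar>) \<le> (\<Sum>k\<in>I. \<bar>q k - q (p k)\<bar>)"
proof -
  define G where "G j k = burgers_flux (Z j k) - burgers_flux (Z j (p k))" for j k
  have abs_sign: "\<bar>x\<bar> = \<sigma> k * x" if "k \<in> I" "0 \<le> \<sigma> k * x" for k x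
    using sign[OF that(1)] that(2) by auto
  have le_abs: "\<sigma> k * x \<le> \<bar>x\<bar>" if "k \<in> I" for k x
    using sign[OF that] by auto
  have G: "0 \<le> (\<Sum>k\<in>I. \<sigma> k * (G j k - G j (p k)))" if "j \<in> {1..S}" for j
  proof -
    have "(\<Sum>k\<in>I. \<bar>G j (p k)\<bar>) = (\<Sum>k\<in>I. \<bar>G j k\<bar>)"
      by (rule sum.reindex_bij_betw[OF bij])
    then have "0 = (\<Sum>k\<in>I. \<bar>G j k\<bar> - \<bar>G j (p k)\<bar>)" by (simp add: sum_subtractf)
    also have "\<dots> \<le> (\<Sum>k\<in>I. \<sigma> k * (G j k - G j (p k)))"
    proof (rule sum_mono)
      fix k assume k: "k \<in> I"
      have "\<bar>G j k\<bar> = \<sigma> k * G j k"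
        by (rule abs_sign[OF k]) (simp add: G_def sign_preserved(2)[OF that k])
      then show "\<bar>G j k\<bar> - \<bar>G j (p k)\<bar> \<le> \<sigma> k * (G j k - G j (p k))"
        using le_abs[OF k, of "G j (p k)"] by (simp add: right_diff_distrib)
    qed
    finally show ?thesis .
  qed
  \<comment> \<open>The sign weights make the variation linear in \<open>Z i\<close>, so the stage
    equation can be inserted; for \<open>q\<close> the bound \<open>le_abs\<close> suffices at the
    end.\<close>
  have "(\<Sum>k\<in>I. \<bar>Z i k - Z i (p k)\<bar>) = (\<Sum>k\<in>I. \<sigma> k * (Z i k - Z i (p k)))"
    by (intro sum.cong refl abs_sign sign_preserved(1)[OF assms])
  also have "\<dots> = (\<Sum>k\<in>I. \<sigma> k * (q k - q (p k)) -
      \<nu> * (\<Sum>j\<in>{1..<i}. a i j * (\<sigma> k * (G j k - G j (p k)))))"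
  proof (rule sum.cong[OF refl])
    fix k assume k: "k \<in> I"
    show "\<sigma> k * (Z i k - Z i (p k)) = \<sigma> k * (q k - q (p k)) -
      \<nu> * (\<Sum>j\<in>{1..<i}. a i j * (\<sigma> k * (G j k - G j (p k))))"
      unfolding stage[OF assms k] stage[OF assms p_in[OF k]] G_def[symmetric]
      by (simp add: algebra_simps sum_subtractf sum_distrib_left)
  qed
  also have "\<dots> = (\<Sum>k\<in>I. \<sigma> k * (q k - q (p k))) -
      \<nu> * (\<Sum>j\<in>{1..<i}. a i j * (\<Sum>k\<in>I. \<sigma> k * (G j k - G j (p k))))"
  proof -
    have "(\<Sum>k\<in>I. \<Sum>j\<in>{1..<i}. a i j * (\<sigma> k * (G j k - G j (p k)))) =
        (\<Sum>j\<in>{1..<i}. a i j * (\<Sum>k\<in>I. \<sigma> k * (G j k - G j (p k))))"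
      by (subst sum.swap) (simp only: sum_distrib_left)
    then show ?thesis by (simp only: sum_subtractf sum_distrib_left[of \<nu>, symmetric])
  qed
  also have "\<dots> \<le> (\<Sum>k\<in>I. \<sigma> k * (q k - q (p k)))"
  proof -
    have "0 \<le> \<nu> * (\<Sum>j\<in>{1..<i}. a i j * (\<Sum>k\<in>I. \<sigma> k * (G j k - G j (p k))))"
    proof (intro mult_nonneg_nonneg sum_nonneg[of "{1..<i}"])
      fix j assume j: "j \<in> {1..<i}"
      show "0 \<le> a i j" by (rule a_nonneg[OF assms j])
      show "0 \<le> (\<Sum>k\<in>I. \<sigma> k * (G j k - G j (p k)))" using j assms by (intro G) auto
    qed (use lam(1) in simp)
    then show ?thesis by linarith
  qed
  also have "\<dots> \<le> (\<Sum>k\<in>I. \<bar>q k - q (p k)\<bar>)"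
    by (intro sum_mono le_abs)
  finally show ?thesis .
qed

end

section \<open>Left neighbours and total variation on the periodic grid\<close>

definition left_nb :: "nat \<Rightarrow> nat \<Rightarrow> nat" where
  "left_nb N k = (k + N - 1) mod N"

lemma upwind_left_nb:
  "upwind N \<Delta>x q k = - (1 / \<Delta>x) * (burgers_flux (q k) - burgers_flux (q (left_nb N k)))"
  by (simp add: upwind_def left_nb_def)

lemma left_nb_less: "k < N \<Longrightarrow> left_nb N k < N"
  by (simp add: left_nb_def)

lemma left_nb_right_nb:
  assumes "k < N"
  shows "left_nb N ((k + 1) mod N) = k" "(left_nb N k + 1) mod N = k"
proof -
  have "left_nb N ((k + 1) mod N) = ((k + 1) mod N + (N - 1)) mod N"
    using assms by (simp add: left_nb_def)
  also have "\<dots> = (k + 1 + (N - 1)) mod N" by (rule mod_add_left_eq)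
  finally show "left_nb N ((k + 1) mod N) = k" using assms by simp
  show "(left_nb N k + 1) mod N = k" using assms by (simp add: left_nb_def mod_Suc_eq)
qed

lemma bij_left_nb: "bij_betw (left_nb N) {..<N} {..<N}"
  by (rule bij_betw_byWitness[where f' = "\<lambda>k. (k + 1) mod N"])
    (auto simp: left_nb_right_nb[simplified] left_nb_less)

lemma TV_left: "TV N q = (\<Sum>k<N. \<bar>q k - q (left_nb N k)\<bar>)"
proof -
  have "TV N q = (\<Sum>k<N. \<bar>q ((left_nb N k + 1) mod N) - q (left_nb N k)\<bar>)"
    unfolding TV_def by (rule sum.reindex_bij_betw[OF bij_left_nb, symmetric])
  also have "\<dots> = (\<Sum>k<N. \<bar>q k - q (left_nb N k)\<bar>)"
    by (intro sum.cong refl) (simp only: left_nb_right_nb(2) lessThan_iff)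
  finally show ?thesis .
qed

text \<open>A step to the left is addition of \<open>N - 1\<close> modulo \<open>N\<close>, which
  keeps the iteration free of truncated subtraction.\<close>

lemma funpow_left_nb:
  assumes "k < N"
  shows "(left_nb N ^^ n) k = (k + n * (N - 1)) mod N"
proof (induction n)
  case (Suc n)
  have "(left_nb N ^^ Suc n) k = ((k + n * (N - 1)) mod N + (N - 1)) mod N"
    using assms by (simp add: Suc) (simp add: left_nb_def)
  also have "\<dots> = (k + n * (N - 1) + (N - 1)) mod N"
    by (rule mod_add_left_eq)
  also have "\<dots> = (k + Suc n * (N - 1)) mod N"
    by (simp add: ac_simps)
  finally show ?case .
qed (use assms in simp)

lemma left_nb_transitive:
  assumes "k < N" "l < N"
  obtains n where "(left_nb N ^^ n) k = l"
proof
  \<comment> \<open>Each step subtracts 1 modulo \<open>N\<close>; the step count is congruent to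
    \<open>k - l\<close>, with \<open>N\<close> added to keep it natural.\<close>
  have *: "k + (k + (N - l)) * (N - 1) = l + (k + (N - l) - 1) * N"
  proof -
    obtain d where d: "N = Suc (l + d)" using assms(2) less_iff_Suc_add by auto
    show ?thesis by (simp add: d algebra_simps)
  qed
  show "(left_nb N ^^ (k + (N - l))) k = l"
    unfolding funpow_left_nb[OF assms(1)] * using assms(2) by simp
qed

lemma left_nb_jump_exists:
  assumes "k < N" "l < N" "q l \<noteq> q (left_nb N l)"
  shows "\<exists>n. q ((left_nb N ^^ n) k) \<noteq> q (left_nb N ((left_nb N ^^ n) k))"
  using left_nb_transitive[OF assms(1,2)] assms(3) by metis

lemma finite_pos_lower_bound:
  fixes A :: "real set"
  assumes "finite A"
  obtains \<epsilon> where "0 < \<epsilon>" "\<epsilon> \<le> 1" "\<And>x. x \<in> A \<Longrightarrow> 0 < x \<Longrightarrow> \<epsilon> \<le> x"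
proof
  \<comment> \<open>The element 1 makes the set nonempty and enforces the upper bound 1.\<close>
  let ?B = "insert 1 {x \<in> A. 0 < x}"
  have "finite ?B" using assms by simp
  then show "0 < Min ?B" "Min ?B \<le> 1" "\<And>x. x \<in> A \<Longrightarrow> 0 < x \<Longrightarrow> Min ?B \<le> x"
    by (auto intro!: Min_le simp del: Min_insert)
qed

section \<open>Appending the final update as a stage, and the case of constant data\<close>

lemma rk_stage_cong:
  assumes "\<And>i j. i \<le> s \<Longrightarrow> a' i j = a i j" "i \<le> s"
  shows "rk_stage R a' \<Delta>t q i = rk_stage R a \<Delta>t q i"
  using assms(2)
proof (induction i rule: less_induct)
  case (less i)
  then show ?case
    by (subst (1 2) rk_stage.simps) (auto simp: assms(1) intro!: ext sum.cong)
qed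

text \<open>Stages up to \<open>s\<close> do not read the appended row, and row \<open>Suc s\<close>
  sums over exactly the stages 1 to \<open>s\<close>.\<close>

lemma rk_step_as_stage:
  "rk_step R s a b \<Delta>t q = rk_stage R (\<lambda>i. if i \<le> s then a i else b) \<Delta>t q (Suc s)"
proof -
  have "rk_stage R (\<lambda>i. if i \<le> s then a i else b) \<Delta>t q j = rk_stage R a \<Delta>t q j" if "j \<le> s" for j
    by (rule rk_stage_cong[OF _ that]) simp
  then show ?thesis
    by (subst rk_stage.simps)
      (simp add: rk_step_def atLeastLessThanSuc_atLeastAtMost del: sum.op_ivl_Suc)
qed

text \<open>Treated separately because without a jump \<open>r\<close> and \<sigma> have no meaning;
  such data are an equilibrium of the scheme.\<close>

lemma rk_stage_upwind_const:
  assumes "\<And>k. k < N \<Longrightarrow> q (left_nb N k) = q k" "k < N"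
  shows "rk_stage (upwind N \<Delta>x) a \<Delta>t q i k = q k"
  using assms(2)
proof (induction i arbitrary: k rule: less_induct)
  case (less i)
  have "upwind N \<Delta>x (rk_stage (upwind N \<Delta>x) a \<Delta>t q j) k = 0" if "j \<in> {1..<i}" for j
    using less.IH[of j k] less.IH[of j "left_nb N k"] that less.prems assms(1)[OF less.prems]
      left_nb_less[OF less.prems]
    by (subst upwind_left_nb) simp
  then show ?case by (subst rk_stage.simps) simp
qed

section \<open>Small time steps for the periodic scheme\<close>

lemma TV_rk_stage_upwind_le:
  assumes "\<Delta>x > 0"
    and q: "\<forall>i<N. 0 \<le> q i \<and> q i \<le> 1"
    and a_nonneg: "\<And>i j. i \<in> {1..S} \<Longrightarrow> j \<in> {1..<i} \<Longrightarrow> 0 \<le> a i j"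
    and a_row: "\<And>i. i \<in> {1..S} \<Longrightarrow> (\<Sum>j\<in>{1..<i}. a i j) \<le> 1"
  shows "\<exists>\<Delta>t_max>0. \<forall>\<Delta>t. 0 < \<Delta>t \<and> \<Delta>t \<le> \<Delta>t_max \<longrightarrow>
    (\<forall>i\<in>{1..S}. TV N (rk_stage (upwind N \<Delta>x) a \<Delta>t q i) \<le> TV N q)"
proof (cases "\<forall>k<N. q (left_nb N k) = q k")
  case True
  then have "TV N (rk_stage (upwind N \<Delta>x) a \<Delta>t q i) = TV N q" for \<Delta>t i
    by (simp add: TV_left rk_stage_upwind_const left_nb_less)
  then show ?thesis by (auto intro: exI[of _ 1])
next
  case False
  then obtain l where l: "l < N" "q l \<noteq> q (left_nb N l)" by fastforce
  let ?p = "left_nb N"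
  define J where "J k n \<longleftrightarrow> q ((?p ^^ n) k) \<noteq> q (?p ((?p ^^ n) k))" for k n
  define r where "r k = (LEAST n. J k n)" for k
  define \<sigma> where "\<sigma> k = sgn (q ((?p ^^ r k) k) - q (?p ((?p ^^ r k) k)))" for k
  define M where "M = Max (r ` {..<N})"
  \<comment> \<open>A jump exists at \<open>l\<close>, and iterating the left neighbour map reaches
    it from every \<open>k\<close>, so the least index is attained.\<close>
  have J: "J k (r k)" if "k < N" for k
    using left_nb_jump_exists[OF that l] unfolding r_def J_def[symmetric] by (rule LeastI_ex)
  have J_Suc: "J k (Suc n) \<longleftrightarrow> J (?p k) n" for k n
    by (simp add: J_def funpow_swap1)
  obtain \<epsilon> where eps: "0 < \<epsilon>" "\<epsilon> \<le> 1"
    and gap: "\<And>x. x \<in> q ` {..<N} \<union> (\<lambda>k. \<bar>q k - q (?p k)\<bar>) ` {..<N} \<Longrightarrow> 0 < x \<Longrightarrow> \<epsilon> \<le> x"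
    by (rule finite_pos_lower_bound[of "q ` {..<N} \<union> (\<lambda>k. \<bar>q k - q (?p k)\<bar>) ` {..<N}"]) auto
  \<comment> \<open>\<open>T\<close> is the smallness condition on \<nu> =
    \<open>\<Delta>t / \<Delta>x\<close> solved for \<Delta>t.\<close>
  define T where "T = \<Delta>x * (\<epsilon>\<^sup>2 / (64 * 4 ^ M))"
  have "TV N (rk_stage (upwind N \<Delta>x) a \<Delta>t q i) \<le> TV N q"
    if \<Delta>t: "0 < \<Delta>t" "\<Delta>t \<le> T" and i: "i \<in> {1..S}" for \<Delta>t i
  proof -
    interpret small_step_upwind "{..<N}" ?p q S a "\<Delta>t / \<Delta>x"
      "rk_stage (upwind N \<Delta>x) a \<Delta>t q" \<sigma> r \<epsilon> M
    proof
      show "bij_betw ?p {..<N} {..<N}" by (rule bij_left_nb)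
      show "0 < \<epsilon>" "\<epsilon> \<le> 1" by (fact eps)+
      show "0 < \<Delta>t / \<Delta>x" using \<Delta>t assms(1) by simp
      show "64 * 4 ^ M * (\<Delta>t / \<Delta>x) \<le> \<epsilon>\<^sup>2"
        using \<Delta>t(2) assms(1) by (simp add: T_def field_simps)
    next
      fix i k
      show "rk_stage (upwind N \<Delta>x) a \<Delta>t q i k = q k - \<Delta>t / \<Delta>x * (\<Sum>j\<in>{1..<i}. a i j *
        (burgers_flux (rk_stage (upwind N \<Delta>x) a \<Delta>t q j k) -
         burgers_flux (rk_stage (upwind N \<Delta>x) a \<Delta>t q j (?p k))))"
        by (subst rk_stage.simps)
          (simp add: upwind_left_nb sum_distrib_left sum_negf[symmetric] mult_ac)
    next
      fix k assume "k \<in> {..<N}"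
      then have k: "k < N" by simp
      show "0 \<le> q k \<and> q k \<le> 1" using q k by blast
      show "q k = 0 \<or> \<epsilon> \<le> q k" using gap[of "q k"] k q by fastforce
      show "r k \<le> M" using k by (simp add: M_def)
      show "\<sigma> k = 1 \<or> \<sigma> k = - 1"
        using J[OF k] by (auto simp: \<sigma>_def J_def sgn_if)
      {
        assume r0: "r k = 0"
        then have "q k \<noteq> q (?p k)" using J[OF k] by (simp add: J_def)
        then have "\<epsilon> \<le> \<bar>q k - q (?p k)\<bar>" using k by (intro gap) auto
        then show "\<epsilon> \<le> \<sigma> k * (q k - q (?p k))"
          by (simp add: \<sigma>_def r0 abs_sgn mult.commute)
      next
        fix n assume rS: "r k = Suc n"
        then have "\<not> J k 0" using not_less_Least[of 0 "J k"] by (simp add: r_def)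
        \<comment> \<open>Seen from \<open>?p k\<close> every positive jump index drops by one;
          index 0 is not a jump for \<open>k\<close>, so the least index drops by one as
          well.\<close>
        moreover have "r (?p k) = n"
        proof -
          have "r k = Suc (LEAST n. J k (Suc n))"
            unfolding r_def using J[OF k] \<open>\<not> J k 0\<close> by (rule Least_Suc)
          then show ?thesis using rS by (simp add: r_def J_Suc)
        qed
        moreover from this have "\<sigma> (?p k) = \<sigma> k"
          by (simp add: \<sigma>_def rS funpow_swap1)
        ultimately show "q (?p k) = q k \<and> \<sigma> (?p k) = \<sigma> k \<and> r (?p k) = n"
          by (simp add: J_def)
      }
    qed (use a_nonneg a_row in auto)
    show ?thesis unfolding TV_left using variation_le[OF i] .
  qed
  moreover have "0 < T" using assms(1) eps by (simp add: T_def)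
  ultimately show ?thesis by blast
qed

theorem theorem10:
  fixes N s :: nat and \<Delta>x :: real and q :: grid_vec
    and a :: "nat \<Rightarrow> nat \<Rightarrow> real" and b :: "nat \<Rightarrow> real"
  assumes "N \<ge> 1" and "\<Delta>x > 0"
    and "\<forall>i<N. 0 \<le> q i \<and> q i \<le> 1"
    and "explicit_rk s a b"
    and "\<forall>i\<in>{1..s}. \<forall>j\<in>{1..s}. 0 \<le> a i j \<and> a i j \<le> 1"
    and "\<forall>i\<in>{1..s}. 0 \<le> rk_c s a i \<and> rk_c s a i \<le> 1"
    and "\<forall>j\<in>{1..s}. 0 \<le> b j \<and> b j \<le> 1"
  shows "\<exists>\<Delta>t_max>0. \<forall>\<Delta>t. 0 < \<Delta>t \<and> \<Delta>t \<le> \<Delta>t_max \<longrightarrow>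
           (\<forall>j\<in>{1..s}. TV N (rk_stage (upwind N \<Delta>x) a \<Delta>t q j) \<le> TV N q) \<and>
           TV N (rk_step (upwind N \<Delta>x) s a b \<Delta>t q) \<le> TV N q"
proof -
  \<comment> \<open>The weights \<open>b\<close> become row \<open>Suc s\<close>; they sum to 1, so
    the row condition extends to the final update.\<close>
  let ?a = "\<lambda>i. if i \<le> s then a i else b"
  have row: "(\<Sum>j\<in>{1..<i}. ?a i j) \<le> 1" if i: "i \<in> {1..Suc s}" for i
  proof (cases "i \<le> s")
    case True
    then have "(\<Sum>j\<in>{1..<i}. a i j) \<le> rk_c s a i"
      unfolding rk_c_def using assms(5) i by (intro sum_mono2) auto
    moreover have "rk_c s a i \<le> 1" using assms(6) True i by simp
    ultimately show ?thesis using True by simp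
  next
    case False
    then have "i = Suc s" using i by simp
    then show ?thesis using assms(4) by (simp add: explicit_rk_def atLeastLessThanSuc_atLeastAtMost)
  qed
  have nonneg: "0 \<le> ?a i j" if "i \<in> {1..Suc s}" "j \<in> {1..<i}" for i j
    using that assms(5,7) by auto
  from TV_rk_stage_upwind_le[of \<Delta>x N q "Suc s" ?a, OF assms(2,3) nonneg row]
  obtain T where T: "T > 0" "\<And>\<Delta>t i. 0 < \<Delta>t \<Longrightarrow> \<Delta>t \<le> T \<Longrightarrow> i \<in> {1..Suc s} \<Longrightarrow>
      TV N (rk_stage (upwind N \<Delta>x) ?a \<Delta>t q i) \<le> TV N q"
    by blast
  have stages: "rk_stage R ?a \<Delta>t q j = rk_stage R a \<Delta>t q j" if "j \<in> {1..s}" for R \<Delta>t j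
    by (rule rk_stage_cong[where s = s]) (use that in auto)
  show ?thesis
  proof (intro exI[of _ T] conjI allI impI ballI)
    show "T > 0" by (fact T(1))
    fix \<Delta>t assume \<Delta>t: "0 < \<Delta>t \<and> \<Delta>t \<le> T"
    show "TV N (rk_step (upwind N \<Delta>x) s a b \<Delta>t q) \<le> TV N q"
      unfolding rk_step_as_stage using T(2)[of \<Delta>t "Suc s"] \<Delta>t by simp
    show "TV N (rk_stage (upwind N \<Delta>x) a \<Delta>t q j) \<le> TV N q" if "j \<in> {1..s}" for j
      using T(2)[of \<Delta>t j] \<Delta>t that by (simp add: stages[OF that, symmetric])
  qed
qed

end
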